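(* Let $X\subset\mathcal{X}$ be finite, $w:\mathcal{X}\times\mathcal{X}\to[0,1]$, $M\ge1$ and $\beta\in[0,1]$, and let $Z_T$ be a $p^2$-weighted multi-resolution hashing-based estimator for $w$ which is $(\beta,M)$-scale free. Then for every $y\in\mathcal{X}$, with $\mu=\frac{1}{|X|}\sum_{x\in X}w(x,y)$, $$\mathbb{E}[Z_T^2(y)]\le V_{\beta,M}(\mu):=8M^3\mu^2\Big[\frac{1}{\mu^{\beta}}+\frac{1}{\mu^{1-\beta}}\Big]+\mu^2.$$
   Context: A hashing scheme $\mathcal{H}$ on $\mathcal{X}$ is a distribution over pairs $(h,g)$ of functions $\mathcal{X}\to\mathcal{U}$ with collision probability $p(x,y)=\mathbb{P}[h(x)=g(y)]$; the hash bucket of $y$ is $H(y)=\{x\in X:h(x)=g(y)\}$. Given hashing schemes $\mathcal{H}_1,\dots,\mathcal{H}_T$ with collision probabilities $p_t$ and weights $w_t$, the multi-resolution hashing-based estimator independently samples $(h_t,g_t)\sim\mathcal{H}_t$, lets $X_t$ be uniform in $H_t(y)$ (or $\perp$ if empty) and outputs $Z_T(y)=\frac{1}{|X|}\sum_t\frac{w_t(X_t,y)}{p_t(X_t,y)}|H_t(y)|$ (terms with $X_t=\perp$ are $0$). It is $p^2$-weighted if $w_t(x,y)=\frac{p_t^2(x,y)}{W(x,y)}w(x,y)$, $W(x,y)=\sum_{t:p_t(x,y)>0}p_t^2(x,y)$, and unbiased ($w(x,y)>0$ implies $p_t(x,y)>0$ for some $t$). Let $p_*(x,y)=\sup_{t\in[T]}p_t(x,y)$.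 The estimator is $(\beta,M)$-scale free if $M^{-1}w^{\beta}(x,y)\le p_*(x,y)\le Mw^{\beta}(x,y)$ for all $x\in X$, $y\in\mathcal{X}$. *)

theory Defs
  imports "HOL-Probability.Probability"
begin

type_synonym ('a, 'u) hash_pair = "('a \<Rightarrow> 'u) \<times> ('a \<Rightarrow> 'u)"

text \<open>A hashing scheme is an arbitrary (not necessarily discrete) probability measure on pairs
  \<open>(h, g)\<close> of functions, for which the collision events are measurable.\<close>

definition hashing_scheme :: "('a, 'u) hash_pair measure \<Rightarrow> bool" where
  "hashing_scheme H \<longleftrightarrow>
     prob_space H \<and> (\<forall>x y. {hg \<in> space H. fst hg x = snd hg y} \<in> sets H)"

definition coll_prob :: "('a, 'u) hash_pair measure \<Rightarrow> 'a \<Rightarrow> 'a \<Rightarrow> real" where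
  "coll_prob H x y = measure H {hg \<in> space H. fst hg x = snd hg y}"

definition bucket :: "'a set \<Rightarrow> ('a, 'u) hash_pair \<Rightarrow> 'a \<Rightarrow> 'a set" where
  "bucket X hg y = {x \<in> X. fst hg x = snd hg y}"

text \<open>\<open>None\<close> plays the role of \<open>\<bottom>\<close>.\<close>

definition bucket_sample :: "'a set \<Rightarrow> ('a, 'u) hash_pair \<Rightarrow> 'a \<Rightarrow> 'a option pmf" where
  "bucket_sample X hg y =
     (if bucket X hg y = {} then return_pmf None
      else map_pmf Some (pmf_of_set (bucket X hg y)))"

text \<open>The joint law of \<open>((h\<^sub>t, g\<^sub>t), X\<^sub>t)\<close>: draw \<open>(h\<^sub>t, g\<^sub>t)\<close> from the scheme, then
  \<open>X\<^sub>t\<close> uniformly from the bucket of \<open>y\<close>.\<close>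

definition sample_law ::
  "'a set \<Rightarrow> ('a, 'u) hash_pair measure \<Rightarrow> 'a \<Rightarrow> (('a, 'u) hash_pair \<times> 'a option) measure" where
  "sample_law X H y =
     bind H (\<lambda>hg. distr (measure_pmf (bucket_sample X hg y)) (H \<Otimes>\<^sub>M count_space UNIV) (Pair hg))"

definition mr_law ::
  "'a set \<Rightarrow> nat \<Rightarrow> (nat \<Rightarrow> ('a, 'u) hash_pair measure) \<Rightarrow> 'a
     \<Rightarrow> (nat \<Rightarrow> ('a, 'u) hash_pair \<times> 'a option) measure" where
  "mr_law X T H y = PiM {1..T} (\<lambda>t. sample_law X (H t) y)"

definition mr_estimator ::
  "'a set \<Rightarrow> nat \<Rightarrow> (nat \<Rightarrow> ('a, 'u) hash_pair measure) \<Rightarrow> (nat \<Rightarrow> 'a \<Rightarrow> 'a \<Rightarrow> real) \<Rightarrow> 'a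
     \<Rightarrow> (nat \<Rightarrow> ('a, 'u) hash_pair \<times> 'a option) \<Rightarrow> real" where
  "mr_estimator X T H wt y \<omega> =
     1 / real (card X) *
     (\<Sum>t\<in>{1..T}. case snd (\<omega> t) of
         None \<Rightarrow> 0
       | Some x \<Rightarrow> wt t x y / coll_prob (H t) x y * real (card (bucket X (fst (\<omega> t)) y)))"

definition sq_weight_sum ::
  "nat \<Rightarrow> (nat \<Rightarrow> ('a, 'u) hash_pair measure) \<Rightarrow> 'a \<Rightarrow> 'a \<Rightarrow> real" where
  "sq_weight_sum T H x y =
     (\<Sum>t | t \<in> {1..T} \<and> coll_prob (H t) x y > 0. (coll_prob (H t) x y)\<^sup>2)"

definition p2_weighted ::
  "'a set \<Rightarrow> nat \<Rightarrow> (nat \<Rightarrow> ('a, 'u) hash_pair measure) \<Rightarrow> ('a \<Rightarrow> 'a \<Rightarrow> real)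
     \<Rightarrow> (nat \<Rightarrow> 'a \<Rightarrow> 'a \<Rightarrow> real) \<Rightarrow> bool" where
  "p2_weighted X T H w wt \<longleftrightarrow>
     (\<forall>t\<in>{1..T}. \<forall>x\<in>X. \<forall>y.
        wt t x y = (coll_prob (H t) x y)\<^sup>2 / sq_weight_sum T H x y * w x y)"

definition unbiased ::
  "'a set \<Rightarrow> nat \<Rightarrow> (nat \<Rightarrow> ('a, 'u) hash_pair measure) \<Rightarrow> ('a \<Rightarrow> 'a \<Rightarrow> real) \<Rightarrow> bool" where
  "unbiased X T H w \<longleftrightarrow>
     (\<forall>x\<in>X. \<forall>y. w x y > 0 \<longrightarrow> (\<exists>t\<in>{1..T}. coll_prob (H t) x y > 0))"

definition p_star ::
  "nat \<Rightarrow> (nat \<Rightarrow> ('a, 'u) hash_pair measure) \<Rightarrow> 'a \<Rightarrow> 'a \<Rightarrow> real" where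
  "p_star T H x y = (SUP t\<in>{1..T}. coll_prob (H t) x y)"

text \<open>Real powers of nonnegative reals with the convention \<open>0\<^sup>0 = 1\<close>, whereas
  \<open>0 powr 0 = 0\<close>.\<close>

definition rpow :: "real \<Rightarrow> real \<Rightarrow> real" where
  "rpow a b = (if b = 0 then 1 else a powr b)"

definition scale_free ::
  "'a set \<Rightarrow> nat \<Rightarrow> (nat \<Rightarrow> ('a, 'u) hash_pair measure) \<Rightarrow> ('a \<Rightarrow> 'a \<Rightarrow> real)
     \<Rightarrow> real \<Rightarrow> real \<Rightarrow> bool" where
  "scale_free X T H w \<beta> M \<longleftrightarrow>
     (\<forall>x\<in>X. \<forall>y. inverse M * rpow (w x y) \<beta> \<le> p_star T H x y \<and>
                 p_star T H x y \<le> M * rpow (w x y) \<beta>)"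

definition mean_weight :: "'a set \<Rightarrow> ('a \<Rightarrow> 'a \<Rightarrow> real) \<Rightarrow> 'a \<Rightarrow> real" where
  "mean_weight X w y = 1 / real (card X) * (\<Sum>x\<in>X. w x y)"

text \<open>At \<open>\<mu> = 0\<close> the factor \<open>\<mu>\<^sup>2\<close> makes this \<open>0\<close>, the limit of the formula as
  \<open>\<mu>\<close> tends to \<open>0\<close>.\<close>

definition V_bound :: "real \<Rightarrow> real \<Rightarrow> real \<Rightarrow> real" where
  "V_bound \<beta> M \<mu> =
     8 * M ^ 3 * \<mu>\<^sup>2 * (1 / rpow \<mu> \<beta> + 1 / rpow \<mu> (1 - \<beta>)) + \<mu>\<^sup>2"

end

theory Submission imports Defs begin

text \<open>Write \<open>Z\<close> as the sum of the independent contributions \<open>Z\<^sub>t\<close> of the schemes. Then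
  \<open>E Z\<^sup>2 \<le> (\<Sum>t. E Z\<^sub>t\<^sup>2) + (E Z)\<^sup>2\<close> and \<open>E Z = \<mu>\<close>. Two points collide with \<open>y\<close> simultaneously with probability at most the
  smaller of their collision probabilities, so the \<open>p\<^sup>2\<close>-weights give
  \<open>|X|\<^sup>2 (\<Sum>t. E Z\<^sub>t\<^sup>2) \<le> (\<Sum>x z. w\<^sub>x\<^sup>2 p\<^sub>*(z) / p\<^sub>*(x)\<^sup>2)\<close>, and scale-freeness bounds the right-hand side by
  \<open>M\<^sup>3 (\<Sum>x. w\<^sub>x\<^bsup>2 - 2\<beta>\<^esup>) (\<Sum>z. w\<^sub>z\<^bsup>\<beta>\<^esup>)\<close>. Jensen's inequality for concave powers finishes the
  proof, even with the constant 1 in place of 8.\<close>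

section \<open>Second moment of a sum of independent variables\<close>

text \<open>Expanding the square leaves the second moments on the diagonal and, by independence,
  products of means off it. Adding the nonnegative squared means to the diagonal completes the cross
  terms to the square of the total mean.\<close>

lemma second_moment_sum_PiM_le:
  fixes f :: "'i \<Rightarrow> 'b \<Rightarrow> real"
  assumes I: "finite I"
    and prob: "\<And>i. i \<in> I \<Longrightarrow> prob_space (N i)"
    and meas: "\<And>i. i \<in> I \<Longrightarrow> f i \<in> borel_measurable (N i)"
    and sq: "\<And>i. i \<in> I \<Longrightarrow> integrable (N i) (\<lambda>x. (f i x)\<^sup>2)"
  shows "integrable (PiM I N) (\<lambda>\<omega>. (\<Sum>i\<in>I. f i (\<omega> i))\<^sup>2)"
    and "(\<integral>\<omega>. (\<Sum>i\<in>I. f i (\<omega> i))\<^sup>2 \<partial>PiM I N) \<le>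
      (\<Sum>i\<in>I. \<integral>x. (f i x)\<^sup>2 \<partial>N i) + (\<Sum>i\<in>I. \<integral>x. f i x \<partial>N i)\<^sup>2"
proof -
  \<comment> \<open>The locale for product measures wants sigma-finiteness at every index, but
    \<open>N\<close> is controlled only on \<open>I\<close>. A point mass elsewhere repairs this and
    leaves the product over \<open>I\<close> unchanged.\<close>
  define N' where "N' i = (if i \<in> I then N i else return (count_space UNIV) undefined)" for i
  have prob': "prob_space (N' i)" for i
    by (auto simp: N'_def prob intro!: prob_space_return)
  interpret product_sigma_finite N'
    unfolding product_sigma_finite_def using prob_space_imp_sigma_finite[OF prob'] by blast
  have P: "PiM I N = PiM I N'"
    by (intro PiM_cong) (auto simp: N'_def)
  have N': "N' i = N i" if "i \<in> I" for i
    using that by (simp add: N'_def)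
  have int: "integrable (N i) (f i)" if "i \<in> I" for i
    using finite_measure.square_integrable_imp_integrable[OF prob_space.finite_measure[OF prob] meas sq] that
    by blast
  have diag: "integrable (PiM I N) (\<lambda>\<omega>. (f i (\<omega> i))\<^sup>2) \<and>
      (\<integral>\<omega>. (f i (\<omega> i))\<^sup>2 \<partial>PiM I N) = (\<integral>x. (f i x)\<^sup>2 \<partial>N i)" if i: "i \<in> I" for i
  proof -
    have "distr (PiM I N) (N i) (\<lambda>\<omega>. \<omega> i) = N i"
      using prob i by (intro distr_PiM_component)
    then show ?thesis
      using integrable_distr_eq[of "\<lambda>\<omega>. \<omega> i" "PiM I N" "N i" "\<lambda>x. (f i x)\<^sup>2"]
        integral_distr[of "\<lambda>\<omega>. \<omega> i" "PiM I N" "N i" "\<lambda>x. (f i x)\<^sup>2"] meas[OF i] sq[OF i] i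
      by simp
  qed
  have off: "integrable (PiM I N) (\<lambda>\<omega>. f i (\<omega> i) * f j (\<omega> j)) \<and>
      (\<integral>\<omega>. f i (\<omega> i) * f j (\<omega> j) \<partial>PiM I N) = (\<integral>x. f i x \<partial>N i) * (\<integral>x. f j x \<partial>N j)"
    if ij: "i \<in> I" "j \<in> I" "i \<noteq> j" for i j
  proof -
    \<comment> \<open>Padding with the constant 1 turns the two-factor product into a product over
      all of \<open>I\<close>; each padded factor integrates to 1 under a probability
      measure.\<close>
    define g where "g k = (if k = i \<or> k = j then f k else (\<lambda>_. 1))" for k
    have split: "(\<Prod>k\<in>I. G k) = G i * G j" if "\<And>k. k \<in> I \<Longrightarrow> k \<noteq> i \<Longrightarrow> k \<noteq> j \<Longrightarrow> G k = 1" for G :: "'i \<Rightarrow> real"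
    proof -
      have "(\<Prod>k\<in>I. G k) = (\<Prod>k\<in>{i, j}. G k)"
        using I ij that by (intro prod.mono_neutral_right) auto
      then show ?thesis using ij by simp
    qed
    have g: "integrable (N' k) (g k)" if "k \<in> I" for k
      using that int finite_measure.integrable_const[OF prob_space.finite_measure[OF prob[OF that]], of 1]
      by (auto simp: g_def N')
    have "(\<integral>x. g k x \<partial>N' k) = 1" if "k \<in> I" "k \<noteq> i" "k \<noteq> j" for k
      using that prob_space.prob_space[OF prob[OF that(1)]] by (simp add: g_def N')
    then have R: "(\<Prod>k\<in>I. \<integral>x. g k x \<partial>N' k) = (\<integral>x. f i x \<partial>N i) * (\<integral>x. f j x \<partial>N j)"
      using ij by (subst split) (simp_all add: g_def N')
    have L: "(\<Prod>k\<in>I. g k (\<omega> k)) = f i (\<omega> i) * f j (\<omega> j)" for \<omega>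
      by (subst split) (simp_all add: g_def)
    show ?thesis
      using product_integrable_prod[OF I g] product_integral_prod[OF I g]
      unfolding L R P by simp
  qed
  have sq_eq: "(\<Sum>i\<in>I. f i (\<omega> i))\<^sup>2 = (\<Sum>i\<in>I. \<Sum>j\<in>I. f i (\<omega> i) * f j (\<omega> j))" for \<omega>
    by (simp add: power2_eq_square sum_product)
  have all: "integrable (PiM I N) (\<lambda>\<omega>. f i (\<omega> i) * f j (\<omega> j))" if "i \<in> I" "j \<in> I" for i j
    using diag[of i] off[of i j] that by (cases "i = j") (auto simp: power2_eq_square)
  show "integrable (PiM I N) (\<lambda>\<omega>. (\<Sum>i\<in>I. f i (\<omega> i))\<^sup>2)"
    unfolding sq_eq by (intro Bochner_Integration.integrable_sum all)
  define e where "e i = (\<integral>x. f i x \<partial>N i)" for i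
  define s where "s i = (\<integral>x. (f i x)\<^sup>2 \<partial>N i)" for i
  have "(\<integral>\<omega>. (\<Sum>i\<in>I. f i (\<omega> i))\<^sup>2 \<partial>PiM I N) =
      (\<Sum>i\<in>I. \<Sum>j\<in>I. \<integral>\<omega>. f i (\<omega> i) * f j (\<omega> j) \<partial>PiM I N)"
    unfolding sq_eq by (simp add: Bochner_Integration.integral_sum all)
  \<comment> \<open>Off the diagonal this is an equality; on it, \<open>e i * e i\<close> is
    added.\<close>
  also have "\<dots> \<le> (\<Sum>i\<in>I. \<Sum>j\<in>I. (if j = i then s i else 0) + e i * e j)"
    using diag off by (intro sum_mono) (auto simp: e_def s_def power2_eq_square)
  also have "\<dots> = (\<Sum>i\<in>I. s i) + (\<Sum>i\<in>I. e i)\<^sup>2"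
    using I by (simp add: sum.distrib power2_eq_square sum_product)
  finally show "(\<integral>\<omega>. (\<Sum>i\<in>I. f i (\<omega> i))\<^sup>2 \<partial>PiM I N) \<le>
      (\<Sum>i\<in>I. \<integral>x. (f i x)\<^sup>2 \<partial>N i) + (\<Sum>i\<in>I. \<integral>x. f i x \<partial>N i)\<^sup>2"
    by (simp add: e_def s_def)
qed

section \<open>The joint law of a hash pair and its sample\<close>

text \<open>Since \<open>X\<close> is finite, fixing the bucket to be a given set is a finite
  Boolean combination of collision events.\<close>

lemma measurable_bucket:
  assumes "hashing_scheme H" "finite X"
  shows "(\<lambda>hg. bucket X hg y) \<in> measurable H (count_space (Pow X))"
proof -
  have "(\<lambda>hg. bucket X hg y) -` {B} \<inter> space H \<in> sets H" if "B \<subseteq> X" for B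
  proof -
    have [measurable]: "Measurable.pred H (\<lambda>hg. fst hg x = snd hg y)" for x
      using assms(1) by (simp add: hashing_scheme_def pred_def)
    have "(\<lambda>hg. bucket X hg y) -` {B} \<inter> space H =
        {hg \<in> space H. \<forall>x\<in>X. (x \<in> B) = (fst hg x = snd hg y)}"
      using that by (auto simp: bucket_def)
    also have "\<dots> \<in> sets H"
      using \<open>finite X\<close> by measurable
    finally show ?thesis .
  qed
  then show ?thesis
    using \<open>finite X\<close> by (subst measurable_count_space_eq2) (auto simp: bucket_def)
qed

text \<open>Every function on the discrete space \<open>Pow X\<close> is measurable, so this covers
  whatever depends on \<open>hg\<close> only through the bucket, such as its cardinality or the
  sampling probabilities.\<close>

lemma measurable_bucket_fun:
  assumes "hashing_scheme H" "finite X" "\<And>B. F B \<in> space L"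
  shows "(\<lambda>hg. F (bucket X hg y)) \<in> measurable H L"
  by (rule measurable_compose[OF measurable_bucket[OF assms(1,2)]]) (use assms(3) in auto)

lemma set_pmf_bucket_sample:
  assumes "finite X"
  shows "set_pmf (bucket_sample X hg y) \<subseteq> insert None (Some ` X)"
  using finite_subset[of "bucket X hg y" X] assms
  by (auto simp: bucket_sample_def bucket_def)

text \<open>The value 0 at \<open>None\<close> lets the averaging formula cover the empty bucket
  too, where the right-hand side reads 0 / 0 = 0.\<close>

lemma nn_integral_bucket_sample:
  fixes f :: "'a option \<Rightarrow> ennreal"
  assumes "finite X" "f None = 0"
  shows "(\<integral>\<^sup>+v. f v \<partial>measure_pmf (bucket_sample X hg y)) =
    (\<Sum>x\<in>bucket X hg y. f (Some x)) / card (bucket X hg y)"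
proof (cases "bucket X hg y = {}")
  case False
  moreover have "finite (bucket X hg y)"
    using assms by (simp add: bucket_def)
  ultimately show ?thesis
    by (simp add: bucket_sample_def nn_integral_pmf_of_set)
qed (simp add: bucket_sample_def assms)

text \<open>This is what permits integration against the \<open>bind\<close> in
  \<open>sample_law\<close>.\<close>

lemma sample_kernel_measurable:
  assumes H: "hashing_scheme H" and X: "finite X"
  shows "(\<lambda>hg. distr (measure_pmf (bucket_sample X hg y)) (H \<Otimes>\<^sub>M count_space UNIV) (Pair hg))
    \<in> measurable H (subprob_algebra (H \<Otimes>\<^sub>M count_space UNIV))"
proof (rule measurable_subprob_algebra)
  fix hg assume hg: "hg \<in> space H"
  then have Pair: "Pair hg \<in> measurable (measure_pmf (bucket_sample X hg y)) (H \<Otimes>\<^sub>M count_space UNIV)"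
    by (simp add: space_pair_measure)
  show "subprob_space (distr (measure_pmf (bucket_sample X hg y)) (H \<Otimes>\<^sub>M count_space UNIV) (Pair hg))"
    by (intro prob_space_imp_subprob_space prob_space.prob_space_distr Pair prob_space_measure_pmf)
next
  fix A assume A: "A \<in> sets (H \<Otimes>\<^sub>M (count_space UNIV :: 'a option measure))"
  have [measurable]: "(\<lambda>hg. ennreal (pmf (bucket_sample X hg y) v)) \<in> borel_measurable H" for v
  proof -
    have "(\<lambda>hg. (\<lambda>B. ennreal (pmf (if B = {} then return_pmf None else map_pmf Some (pmf_of_set B)) v))
      (bucket X hg y)) \<in> borel_measurable H"
      by (intro measurable_bucket_fun H X) auto
    then show ?thesis by (simp add: bucket_sample_def)
  qed
  have [measurable]: "(\<lambda>hg. indicator A (hg, v) :: ennreal) \<in> borel_measurable H" for v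
    using A by measurable
  \<comment> \<open>For every \<open>hg\<close> the sample lies in the same finite set, so the mass
    of \<open>A\<close> is a finite sum of measurable functions of \<open>hg\<close>.\<close>
  have "(\<lambda>hg. \<Sum>v\<in>insert None (Some ` X). indicator A (hg, v) * ennreal (pmf (bucket_sample X hg y) v))
      \<in> borel_measurable H"
    by measurable
  also have "?this \<longleftrightarrow> (\<lambda>hg. emeasure (distr (measure_pmf (bucket_sample X hg y))
      (H \<Otimes>\<^sub>M count_space UNIV) (Pair hg)) A) \<in> borel_measurable H"
  proof (intro measurable_cong)
    fix hg assume hg: "hg \<in> space H"
    then have Pair: "Pair hg \<in> measurable (measure_pmf (bucket_sample X hg y)) (H \<Otimes>\<^sub>M count_space UNIV)"
      by (simp add: space_pair_measure)
    have "emeasure (distr (measure_pmf (bucket_sample X hg y)) (H \<Otimes>\<^sub>M count_space UNIV) (Pair hg)) A =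
      (\<integral>\<^sup>+z. indicator A z \<partial>distr (measure_pmf (bucket_sample X hg y)) (H \<Otimes>\<^sub>M count_space UNIV) (Pair hg))"
      using A by simp
    also have "\<dots> = (\<integral>\<^sup>+v. indicator A (hg, v) \<partial>measure_pmf (bucket_sample X hg y))"
      using A by (intro nn_integral_distr Pair) auto
    also have "\<dots> = (\<Sum>v\<in>insert None (Some ` X). indicator A (hg, v) * ennreal (pmf (bucket_sample X hg y) v))"
      using X set_pmf_bucket_sample[OF X, of hg y]
      by (intro nn_integral_measure_pmf_support) auto
    finally show "(\<Sum>v\<in>insert None (Some ` X). indicator A (hg, v) * ennreal (pmf (bucket_sample X hg y) v)) =
      emeasure (distr (measure_pmf (bucket_sample X hg y)) (H \<Otimes>\<^sub>M count_space UNIV) (Pair hg)) A"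
      by simp
  qed
  finally show "(\<lambda>hg. emeasure (distr (measure_pmf (bucket_sample X hg y))
      (H \<Otimes>\<^sub>M count_space UNIV) (Pair hg)) A) \<in> borel_measurable H" .
qed simp

lemma
  assumes H: "hashing_scheme H" and X: "finite X"
  shows sets_sample_law: "sets (sample_law X H y) = sets (H \<Otimes>\<^sub>M count_space UNIV)"
    and prob_space_sample_law: "prob_space (sample_law X H y)"
proof -
  interpret prob_space H using H by (simp add: hashing_scheme_def)
  show "sets (sample_law X H y) = sets (H \<Otimes>\<^sub>M count_space UNIV)"
    unfolding sample_law_def by (rule sets_bind) (auto simp: not_empty)
  show "prob_space (sample_law X H y)"
    unfolding sample_law_def
    by (rule prob_space_bind[OF _ sample_kernel_measurable[OF H X]])
      (auto simp: space_pair_measure intro!: AE_I2 prob_space.prob_space_distr prob_space_measure_pmf)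
qed

lemma nn_integral_sample_law:
  assumes H: "hashing_scheme H" and X: "finite X"
    and f: "f \<in> borel_measurable (H \<Otimes>\<^sub>M count_space UNIV)"
    and None: "\<And>hg. f (hg, None) = 0"
  shows "(\<integral>\<^sup>+z. f z \<partial>sample_law X H y) =
    (\<integral>\<^sup>+hg. (\<Sum>x\<in>bucket X hg y. f (hg, Some x)) / card (bucket X hg y) \<partial>H)"
proof -
  have "(\<integral>\<^sup>+z. f z \<partial>sample_law X H y) = (\<integral>\<^sup>+hg. \<integral>\<^sup>+z. f z
      \<partial>distr (measure_pmf (bucket_sample X hg y)) (H \<Otimes>\<^sub>M count_space UNIV) (Pair hg) \<partial>H)"
    unfolding sample_law_def by (rule nn_integral_bind[OF f sample_kernel_measurable[OF H X]])
  also have "\<dots> = (\<integral>\<^sup>+hg. \<integral>\<^sup>+v. f (hg, v) \<partial>measure_pmf (bucket_sample X hg y) \<partial>H)"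
    using f by (intro nn_integral_cong nn_integral_distr) (auto simp: space_pair_measure)
  also have "\<dots> = (\<integral>\<^sup>+hg. (\<Sum>x\<in>bucket X hg y. f (hg, Some x)) / card (bucket X hg y) \<partial>H)"
    by (intro nn_integral_cong nn_integral_bucket_sample X None)
  finally show ?thesis .
qed

section \<open>Moments of the contribution of a single scheme\<close>

text \<open>Replaces the random index set by a fixed one, so that sum and expectation can be
  interchanged.\<close>

lemma sum_bucket_eq:
  assumes "finite X"
  shows "(\<Sum>x\<in>bucket X hg y. F x :: ennreal) = (\<Sum>x\<in>X. F x * indicator {hg. fst hg x = snd hg y} hg)"
proof -
  have "(\<Sum>x\<in>bucket X hg y. F x) = (\<Sum>x\<in>X. if fst hg x = snd hg y then F x else 0)"
    unfolding bucket_def by (rule sum.inter_filter[OF assms])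
  also have "\<dots> = (\<Sum>x\<in>X. F x * indicator {hg. fst hg x = snd hg y} hg)"
    by (intro sum.cong) auto
  finally show ?thesis .
qed

text \<open>The expectation of the square counts the pairs \<open>(x, z)\<close> that both fall into the bucket: the
  factor \<open>|H(y)|\<^sup>2\<close> loses one power to the uniform choice of the sample.\<close>

lemma
  fixes c :: "'a \<Rightarrow> real" and H :: "('a, 'u) hash_pair measure" and X y
  defines "\<phi> \<equiv> \<lambda>z :: ('a, 'u) hash_pair \<times> 'a option. case snd z of None \<Rightarrow> 0
             | Some x \<Rightarrow> c x * real (card (bucket X (fst z) y))"
  assumes H: "hashing_scheme H" and X: "finite X" and c: "\<And>x. x \<in> X \<Longrightarrow> 0 \<le> c x"
  shows sample_law_estimator_measurable: "\<phi> \<in> borel_measurable (sample_law X H y)"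
    and sample_law_estimator_square_integrable: "integrable (sample_law X H y) (\<lambda>z. (\<phi> z)\<^sup>2)"
    and sample_law_estimator_expectation: "(\<integral>z. \<phi> z \<partial>sample_law X H y) = (\<Sum>x\<in>X. c x * coll_prob H x y)"
    and sample_law_estimator_second_moment: "(\<integral>z. (\<phi> z)\<^sup>2 \<partial>sample_law X H y) \<le>
      (\<Sum>x\<in>X. \<Sum>z\<in>X. (c x)\<^sup>2 * min (coll_prob H x y) (coll_prob H z y))"
proof -
  let ?N = "H \<Otimes>\<^sub>M (count_space UNIV :: 'a option measure)"
  interpret H: prob_space H using H by (simp add: hashing_scheme_def)
  interpret S: prob_space "sample_law X H y" by (rule prob_space_sample_law[OF H X])
  have coll [measurable]: "Measurable.pred H (\<lambda>hg. fst hg x = snd hg y)" for x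
    using H by (simp add: hashing_scheme_def pred_def)
  have [measurable]: "(\<lambda>hg. real (card (bucket X hg y))) \<in> borel_measurable H"
    by (rule measurable_bucket_fun[OF H X]) simp
  have [measurable]: "(\<lambda>v. case v of None \<Rightarrow> 0 | Some x \<Rightarrow> c x) \<in> borel_measurable (count_space UNIV)"
    by simp
  \<comment> \<open>Separating the factor of the sample from the factor of the hash pair lets each
    be treated as a function of one coordinate.\<close>
  have "(\<lambda>z. (case snd z of None \<Rightarrow> 0 | Some x \<Rightarrow> c x) * real (card (bucket X (fst z) y)))
      \<in> borel_measurable ?N"
    by measurable
  also have "(\<lambda>z. (case snd z of None \<Rightarrow> 0 | Some x \<Rightarrow> c x) * real (card (bucket X (fst z) y))) = \<phi>"
    by (auto simp: \<phi>_def split: option.split)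
  finally have \<phi> [measurable]: "\<phi> \<in> borel_measurable ?N" .
  then show meas: "\<phi> \<in> borel_measurable (sample_law X H y)"
    by (simp cong: measurable_cong_sets add: sets_sample_law[OF H X])
  have fin: "finite (bucket X hg y)" for hg
    using X by (simp add: bucket_def)
  have cB: "0 \<le> c x" if "x \<in> bucket X hg y" for x hg
    using that c by (simp add: bucket_def)
  have prob: "emeasure H {hg \<in> space H. fst hg x = snd hg y} = ennreal (coll_prob H x y)" for x
    by (simp add: coll_prob_def H.emeasure_eq_measure)
  have p_nonneg: "0 \<le> coll_prob H x y" for x
    by (simp add: coll_prob_def)
  have ind: "(\<integral>\<^sup>+hg. ennreal a * indicator {hg. P hg} hg \<partial>H) = ennreal a * emeasure H {hg \<in> space H. P hg}"
    if [measurable]: "Measurable.pred H P" for a P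
  proof -
    have "(\<integral>\<^sup>+hg. ennreal a * indicator {hg. P hg} hg \<partial>H) =
        (\<integral>\<^sup>+hg. ennreal a * indicator {hg \<in> space H. P hg} hg \<partial>H)"
      by (intro nn_integral_cong) (auto split: split_indicator)
    also have "\<dots> = ennreal a * emeasure H {hg \<in> space H. P hg}"
      by (rule nn_integral_cmult_indicator) measurable
    finally show ?thesis .
  qed
  have ind_meas: "(\<lambda>hg. ennreal a * indicator {hg. P hg} hg) \<in> borel_measurable H"
    if [measurable]: "Measurable.pred H P" for a P
    by measurable

  \<comment> \<open>The bucket size cancels the uniform probability, so averaging over the sample
    gives the sum of \<open>c\<close> over the bucket.\<close>
  have pos: "(\<integral>\<^sup>+z. ennreal (\<phi> z) \<partial>sample_law X H y) = ennreal (\<Sum>x\<in>X. c x * coll_prob H x y)"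
  proof -
    have "(\<integral>\<^sup>+z. ennreal (\<phi> z) \<partial>sample_law X H y) =
        (\<integral>\<^sup>+hg. (\<Sum>x\<in>bucket X hg y. ennreal (\<phi> (hg, Some x))) / card (bucket X hg y) \<partial>H)"
      by (rule nn_integral_sample_law[OF H X]) (measurable, simp add: \<phi>_def)
    also have "\<dots> = (\<integral>\<^sup>+hg. (\<Sum>x\<in>bucket X hg y. ennreal (c x)) \<partial>H)"
    proof (intro nn_integral_cong)
      fix hg
      show "(\<Sum>x\<in>bucket X hg y. ennreal (\<phi> (hg, Some x))) / card (bucket X hg y) =
          (\<Sum>x\<in>bucket X hg y. ennreal (c x))"
      proof (cases "bucket X hg y = {}")
        case False
        then have "0 < real (card (bucket X hg y))" using fin by (simp add: card_gt_0_iff)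
        moreover from this have "(\<Sum>x\<in>bucket X hg y. c x * real (card (bucket X hg y))) /
            real (card (bucket X hg y)) = (\<Sum>x\<in>bucket X hg y. c x)"
          by (simp flip: sum_distrib_right)
        ultimately show ?thesis
          by (simp add: \<phi>_def sum_nonneg divide_ennreal ennreal_of_nat_eq_real_of_nat sum_ennreal cB[of _ hg])
      qed simp
    qed
    also have "\<dots> = (\<Sum>x\<in>X. \<integral>\<^sup>+hg. ennreal (c x) * indicator {hg. fst hg x = snd hg y} hg \<partial>H)"
      unfolding sum_bucket_eq[OF X] by (intro nn_integral_sum ind_meas coll)
    also have "\<dots> = ennreal (\<Sum>x\<in>X. c x * coll_prob H x y)"
      by (simp add: ind prob p_nonneg c ennreal_mult' flip: sum_ennreal)
    finally show ?thesis .
  qed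
  \<comment> \<open>Outside \<open>X\<close> the coefficient \<open>c\<close> may be negative, so
    \<phi> need not be nonnegative everywhere. Samples fall into the bucket, hence into
    \<open>X\<close>, so the negative part still integrates to 0.\<close>
  have neg: "(\<integral>\<^sup>+z. ennreal (- \<phi> z) \<partial>sample_law X H y) = 0"
  proof -
    have "(\<integral>\<^sup>+z. ennreal (- \<phi> z) \<partial>sample_law X H y) =
        (\<integral>\<^sup>+hg. (\<Sum>x\<in>bucket X hg y. ennreal (- \<phi> (hg, Some x))) / card (bucket X hg y) \<partial>H)"
      by (rule nn_integral_sample_law[OF H X]) (measurable, simp add: \<phi>_def)
    also have "\<dots> = (\<integral>\<^sup>+hg. 0 \<partial>H)"
      by (intro nn_integral_cong) (simp add: \<phi>_def ennreal_neg bucket_def c)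
    finally show ?thesis by simp
  qed
  have square: "(\<integral>\<^sup>+z. ennreal ((\<phi> z)\<^sup>2) \<partial>sample_law X H y) \<le>
      ennreal (\<Sum>x\<in>X. \<Sum>z\<in>X. (c x)\<^sup>2 * min (coll_prob H x y) (coll_prob H z y))"
  proof -
    have "(\<integral>\<^sup>+z. ennreal ((\<phi> z)\<^sup>2) \<partial>sample_law X H y) =
        (\<integral>\<^sup>+hg. (\<Sum>x\<in>bucket X hg y. ennreal ((\<phi> (hg, Some x))\<^sup>2)) / card (bucket X hg y) \<partial>H)"
      by (rule nn_integral_sample_law[OF H X]) (measurable, simp add: \<phi>_def)
    also have "\<dots> = (\<integral>\<^sup>+hg. (\<Sum>x\<in>bucket X hg y. \<Sum>z\<in>bucket X hg y. ennreal ((c x)\<^sup>2)) \<partial>H)"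
    proof (intro nn_integral_cong)
      fix hg
      show "(\<Sum>x\<in>bucket X hg y. ennreal ((\<phi> (hg, Some x))\<^sup>2)) / card (bucket X hg y) =
          (\<Sum>x\<in>bucket X hg y. \<Sum>z\<in>bucket X hg y. ennreal ((c x)\<^sup>2))"
      proof (cases "bucket X hg y = {}")
        case False
        then have "0 < real (card (bucket X hg y))" using fin by (simp add: card_gt_0_iff)
        then have "(\<Sum>x\<in>bucket X hg y. (c x * real (card (bucket X hg y)))\<^sup>2) / real (card (bucket X hg y)) =
            (\<Sum>x\<in>bucket X hg y. \<Sum>z\<in>bucket X hg y. (c x)\<^sup>2)"
          by (simp add: power_mult_distrib sum_divide_distrib power2_eq_square field_simps)
        then show ?thesis using \<open>0 < real (card (bucket X hg y))\<close>
          by (simp add: \<phi>_def sum_nonneg divide_ennreal ennreal_of_nat_eq_real_of_nat sum_ennreal del: sum_constant)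
      qed simp
    qed
    also have "\<dots> = (\<integral>\<^sup>+hg. (\<Sum>x\<in>X. \<Sum>z\<in>X. ennreal ((c x)\<^sup>2) *
        indicator {hg. fst hg x = snd hg y \<and> fst hg z = snd hg y} hg) \<partial>H)"
      unfolding sum_bucket_eq[OF X]
      by (intro nn_integral_cong sum.cong refl) (auto simp: sum_distrib_right intro!: sum.cong split: split_indicator)
    also have "\<dots> = (\<Sum>x\<in>X. \<Sum>z\<in>X. \<integral>\<^sup>+hg. ennreal ((c x)\<^sup>2) *
        indicator {hg. fst hg x = snd hg y \<and> fst hg z = snd hg y} hg \<partial>H)"
      by (subst nn_integral_sum, measurable, intro sum.cong refl nn_integral_sum ind_meas) measurable
    also have "\<dots> \<le> (\<Sum>x\<in>X. \<Sum>z\<in>X. ennreal ((c x)\<^sup>2 * min (coll_prob H x y) (coll_prob H z y)))"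
    proof (intro sum_mono)
      fix x z
      have "emeasure H {hg \<in> space H. fst hg x = snd hg y \<and> fst hg z = snd hg y} \<le>
          ennreal (min (coll_prob H x y) (coll_prob H z y))"
        using emeasure_mono[of "{hg \<in> space H. fst hg x = snd hg y \<and> fst hg z = snd hg y}"
            "{hg \<in> space H. fst hg x = snd hg y}" H]
          emeasure_mono[of "{hg \<in> space H. fst hg x = snd hg y \<and> fst hg z = snd hg y}"
            "{hg \<in> space H. fst hg z = snd hg y}" H]
        by (auto simp: prob min_def)
      then show "(\<integral>\<^sup>+hg. ennreal ((c x)\<^sup>2) *
          indicator {hg. fst hg x = snd hg y \<and> fst hg z = snd hg y} hg \<partial>H) \<le>
          ennreal ((c x)\<^sup>2 * min (coll_prob H x y) (coll_prob H z y))"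
        by (subst ind) (auto simp: ennreal_mult' intro!: mult_left_mono)
    qed
    also have "\<dots> = ennreal (\<Sum>x\<in>X. \<Sum>z\<in>X. (c x)\<^sup>2 * min (coll_prob H x y) (coll_prob H z y))"
      by (simp add: sum_ennreal sum_nonneg p_nonneg)
    finally show ?thesis .
  qed
  \<comment> \<open>The bound on the nonnegative integral is finite, which yields integrability and
    carries the bound over to the Bochner integral.\<close>
  show int2: "integrable (sample_law X H y) (\<lambda>z. (\<phi> z)\<^sup>2)"
    using meas square by (intro integrableI_bounded) (auto simp: top_unique less_top[symmetric])
  show "(\<integral>z. (\<phi> z)\<^sup>2 \<partial>sample_law X H y) \<le>
      (\<Sum>x\<in>X. \<Sum>z\<in>X. (c x)\<^sup>2 * min (coll_prob H x y) (coll_prob H z y))"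
    using square nn_integral_eq_integral[OF int2] 
    by (simp add: sum_nonneg p_nonneg)
  have "integrable (sample_law X H y) \<phi>"
    by (rule S.square_integrable_imp_integrable[OF meas int2])
  then show "(\<integral>z. \<phi> z \<partial>sample_law X H y) = (\<Sum>x\<in>X. c x * coll_prob H x y)"
    by (simp add: real_lebesgue_integral_def pos neg sum_nonneg c p_nonneg)
qed

section \<open>Sums of powers of weights with a given mean\<close>

text \<open>A concave power lies below its tangent at \<mu>. In the sum the tangent's linear part
  averages out, because \<mu> is the mean of \<open>u\<close>.\<close>

lemma sum_rpow_le:
  assumes X: "finite X" and u: "\<And>x. x \<in> X \<Longrightarrow> 0 \<le> u x"
    and a: "0 \<le> a" "a \<le> 1" and \<mu>: "0 < \<mu>" "(\<Sum>x\<in>X. u x) = real (card X) * \<mu>"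
  shows "(\<Sum>x\<in>X. rpow (u x) a) \<le> real (card X) * \<mu> powr a"
proof -
  have tangent: "rpow (u x) a \<le> \<mu> powr a * (1 - a + a * (u x / \<mu>))" if x: "x \<in> X" for x
  proof (cases "u x = 0 \<or> a = 0")
    case True
    then show ?thesis using a \<mu> by (auto simp: rpow_def)
  next
    case False
    then have pos: "0 < u x" using u[OF x] by simp
    \<comment> \<open>The tangent bound is the weighted AM-GM inequality for
      \<open>u x / \<mu>\<close> and 1 with weights \<open>a\<close> and
      \<open>1 - a\<close>.\<close>
    have "(u x / \<mu>) powr a * 1 powr (1 - a) \<le> a * (u x / \<mu>) + (1 - a) * 1"
      using a \<mu> pos by (intro Youngs_inequality_0) auto
    then have "u x powr a \<le> \<mu> powr a * (1 - a + a * (u x / \<mu>))"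
      using pos \<mu> by (simp add: powr_divide divide_le_eq mult.commute add.commute)
    then show ?thesis using False by (simp add: rpow_def)
  qed
  have "(\<Sum>x\<in>X. rpow (u x) a) \<le> (\<Sum>x\<in>X. \<mu> powr a * (1 - a + a * (u x / \<mu>)))"
    by (intro sum_mono tangent)
  also have "\<dots> = \<mu> powr a * (real (card X) * (1 - a) + a * ((\<Sum>x\<in>X. u x) / \<mu>))"
    by (simp add: sum.distrib flip: sum_distrib_left sum_divide_distrib)
  also have "\<dots> = real (card X) * \<mu> powr a"
    using \<mu> by (simp add: algebra_simps)
  finally show ?thesis .
qed

text \<open>The sum of \<open>u\<^sup>\<beta>\<close> is bounded by concavity; \<open>u\<^bsup>2 - 2\<beta>\<^esup>\<close> is at most \<open>u\<close> if \<open>\<beta> \<le> 1/2\<close> and is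
  again a concave power otherwise. The two cases produce the two summands of the bound.\<close>

lemma sum_power_product_le:
  assumes X: "finite X" and u: "\<And>x. x \<in> X \<Longrightarrow> 0 \<le> u x" "\<And>x. x \<in> X \<Longrightarrow> u x \<le> 1"
    and b: "0 \<le> b" "b \<le> 1" and \<mu>: "0 < \<mu>" "(\<Sum>x\<in>X. u x) = real (card X) * \<mu>"
  shows "(\<Sum>x\<in>X. u x powr (2 - 2 * b)) * (\<Sum>x\<in>X. rpow (u x) b) \<le>
    (real (card X))\<^sup>2 * (\<mu>\<^sup>2 * (1 / rpow \<mu> b + 1 / rpow \<mu> (1 - b)))"
proof -
  have S: "(\<Sum>x\<in>X. rpow (u x) b) \<le> real (card X) * \<mu> powr b"
    by (rule sum_rpow_le[OF X u(1) b \<mu>])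
  have S0: "0 \<le> (\<Sum>x\<in>X. rpow (u x) b)"
    by (intro sum_nonneg) (simp add: rpow_def)
  have r: "rpow \<mu> a = \<mu> powr a" for a
    using \<mu> by (simp add: rpow_def)
  have sq: "\<mu>\<^sup>2 = \<mu> powr 2"
    using \<mu> by simp
  show ?thesis
  proof (cases "b \<le> 1 / 2")
    case True
    have "u x powr (2 - 2 * b) \<le> u x" if "x \<in> X" for x
      using powr_mono'[of 1 "2 - 2 * b" "u x"] u[OF that] True by (cases "u x = 0") auto
    then have "(\<Sum>x\<in>X. u x powr (2 - 2 * b)) \<le> real (card X) * \<mu>"
      unfolding \<mu>(2)[symmetric] by (intro sum_mono)
    then have "(\<Sum>x\<in>X. u x powr (2 - 2 * b)) * (\<Sum>x\<in>X. rpow (u x) b) \<le>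
        (real (card X) * \<mu>) * (real (card X) * \<mu> powr b)"
      using S S0 \<mu>(1) by (intro mult_mono) auto
    also have "\<dots> = (real (card X))\<^sup>2 * \<mu> powr (1 + b)"
      using \<mu>(1) by (simp add: powr_add power2_eq_square)
    also have "\<mu> powr (1 + b) = \<mu>\<^sup>2 * (1 / rpow \<mu> (1 - b))"
      unfolding r sq using powr_diff[of \<mu> 2 "1 - b"] by simp
    also have "\<dots> \<le> \<mu>\<^sup>2 * (1 / rpow \<mu> b + 1 / rpow \<mu> (1 - b))"
      by (simp add: r distrib_left)
    finally show ?thesis by (simp add: mult_left_mono)
  next
    case False
    \<comment> \<open>The two powers differ only when base and exponent are both 0, thus for
      \<open>b = 1\<close> at zero weights, where \<open>powr\<close> gives 0 and
      \<open>rpow\<close> gives 1.\<close>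
    have "(\<Sum>x\<in>X. u x powr (2 - 2 * b)) \<le> (\<Sum>x\<in>X. rpow (u x) (2 - 2 * b))"
      by (intro sum_mono) (auto simp: rpow_def)
    also have "\<dots> \<le> real (card X) * \<mu> powr (2 - 2 * b)"
      using False b by (intro sum_rpow_le X u(1) \<mu>) auto
    finally have "(\<Sum>x\<in>X. u x powr (2 - 2 * b)) * (\<Sum>x\<in>X. rpow (u x) b) \<le>
        (real (card X) * \<mu> powr (2 - 2 * b)) * (real (card X) * \<mu> powr b)"
      using S S0 by (intro mult_mono) auto
    also have "\<dots> = (real (card X))\<^sup>2 * \<mu> powr (2 - b)"
      using powr_add[of \<mu> "2 - 2 * b" b] by (simp add: power2_eq_square)
    also have "\<mu> powr (2 - b) = \<mu>\<^sup>2 * (1 / rpow \<mu> b)"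
      unfolding r sq using powr_diff[of \<mu> 2 b] by simp
    also have "\<dots> \<le> \<mu>\<^sup>2 * (1 / rpow \<mu> b + 1 / rpow \<mu> (1 - b))"
      by (simp add: r distrib_left)
    finally show ?thesis by (simp add: mult_left_mono)
  qed
qed

section \<open>Coefficients from squared collision probabilities\<close>

lemma coll_prob_nonneg: "0 \<le> coll_prob H x y"
  by (simp add: coll_prob_def)

lemma sq_weight_sum_eq: "sq_weight_sum T H x y = (\<Sum>t\<in>{1..T}. (coll_prob (H t) x y)\<^sup>2)"
  unfolding sq_weight_sum_def
  by (rule sum.mono_neutral_left) (auto simp: order.strict_iff_order coll_prob_nonneg)

lemma coll_prob_le_p_star:
  assumes "t \<in> {1..T}"
  shows "coll_prob (H t) x y \<le> p_star T H x y"
  unfolding p_star_def using assms by (intro cSUP_upper) auto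

text \<open>A supremum over a finite nonempty index set is attained, so its square is one of the
  summands on the right.\<close>

lemma p_star_square_le:
  assumes "1 \<le> T"
  shows "(p_star T H x y)\<^sup>2 \<le> sq_weight_sum T H x y"
proof -
  have "p_star T H x y = Max ((\<lambda>t. coll_prob (H t) x y) ` {1..T})"
    unfolding p_star_def using assms by (intro cSup_eq_Max) auto
  moreover have "Max ((\<lambda>t. coll_prob (H t) x y) ` {1..T}) \<in> (\<lambda>t. coll_prob (H t) x y) ` {1..T}"
    using assms by (intro Max_in) auto
  ultimately obtain t where "t \<in> {1..T}" "p_star T H x y = coll_prob (H t) x y"
    by auto
  then show ?thesis
    using member_le_sum[of t "{1..T}" "\<lambda>t. (coll_prob (H t) x y)\<^sup>2"]
    unfolding sq_weight_sum_eq by simp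
qed

text \<open>One factor cancels; at collision probability 0 both sides are 0 because division by 0
  gives 0.\<close>

lemma p2_coefficient_eq:
  assumes "p2_weighted X T H w wt" "t \<in> {1..T}" "x \<in> X"
  shows "wt t x y / coll_prob (H t) x y = coll_prob (H t) x y * w x y / sq_weight_sum T H x y"
  using assms by (simp add: p2_weighted_def power2_eq_square)

lemma sq_weight_sum_pos:
  assumes "unbiased X T H w" "x \<in> X" "0 < w x y"
  shows "0 < sq_weight_sum T H x y"
proof -
  obtain t where "t \<in> {1..T}" "0 < coll_prob (H t) x y"
    using assms unfolding unbiased_def by blast
  then show ?thesis
    unfolding sq_weight_sum_eq by (intro sum_pos2[of _ t]) auto
qed

text \<open>The normalised squares sum to 1, which makes the estimator's mean equal to \<mu>. The
  normaliser may vanish only at weight 0, where both sides are 0.\<close>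

lemma p2_coefficient_sum:
  assumes p2: "p2_weighted X T H w wt" and ub: "unbiased X T H w" and x: "x \<in> X" and w: "0 \<le> w x y"
  shows "(\<Sum>t\<in>{1..T}. wt t x y / coll_prob (H t) x y * coll_prob (H t) x y) = w x y"
proof -
  have "(\<Sum>t\<in>{1..T}. wt t x y / coll_prob (H t) x y * coll_prob (H t) x y) =
      (\<Sum>t\<in>{1..T}. (coll_prob (H t) x y)\<^sup>2 * (w x y / sq_weight_sum T H x y))"
    using p2_coefficient_eq[OF p2 _ x] by (intro sum.cong) (auto simp: power2_eq_square)
  also have "\<dots> = sq_weight_sum T H x y * (w x y / sq_weight_sum T H x y)"
    by (subst sum_distrib_right[symmetric]) (simp only: sq_weight_sum_eq)
  also have "\<dots> = w x y"
    using sq_weight_sum_pos[OF ub x, of y] w by (cases "w x y = 0") auto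
  finally show ?thesis .
qed

text \<open>The squared coefficients carry \<open>W\<^sup>2\<close> in the denominator, and summing
  the squared collision probabilities cancels one \<open>W\<close>. The remaining \<open>W\<close>
  is at least the squared supremum at \<open>x\<close>. The lower scale-free bound at
  \<open>x\<close> is thus used squared and the upper one at \<open>z\<close> once, giving the cube
  of \<open>M\<close>.\<close>

lemma p2_coefficient_square_sum_le:
  assumes p2: "p2_weighted X T H w wt" and ub: "unbiased X T H w" and sf: "scale_free X T H w \<beta> M"
    and M: "M \<ge> 1" and x: "x \<in> X" and z: "z \<in> X" and w: "0 \<le> w x y"
  shows "(\<Sum>t\<in>{1..T}. (wt t x y / coll_prob (H t) x y)\<^sup>2 * min (coll_prob (H t) x y) (coll_prob (H t) z y))
    \<le> M ^ 3 * (w x y powr (2 - 2 * \<beta>) * rpow (w z y) \<beta>)"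
proof (cases "w x y = 0")
  case True
  then show ?thesis using p2_coefficient_eq[OF p2 _ x] by simp
next
  case False
  then have w: "0 < w x y" using w by simp
  define W where "W = sq_weight_sum T H x y"
  define q where "q = p_star T H x y"
  have W: "0 < W" unfolding W_def by (rule sq_weight_sum_pos[OF ub x w])
  have "1 \<le> T" using ub x w by (force simp: unbiased_def)
  then have qW: "q\<^sup>2 \<le> W" unfolding q_def W_def by (rule p_star_square_le)
  have lower: "w x y powr \<beta> / M \<le> q"
  proof -
    have "inverse M * rpow (w x y) \<beta> \<le> q"
      using sf x unfolding scale_free_def q_def by blast
    moreover have "rpow (w x y) \<beta> = w x y powr \<beta>"
      using w by (simp add: rpow_def)
    ultimately show ?thesis by (simp add: divide_inverse mult.commute)
  qed
  then have q: "0 < q" using w M by (smt (verit) divide_pos_pos powr_gt_zero)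
  have pz: "0 \<le> p_star T H z y" 
    using coll_prob_le_p_star[of 1 T H z y] coll_prob_nonneg[of "H 1" z y] \<open>1 \<le> T\<close> by simp
  have "(w x y)\<^sup>2 / W \<le> (w x y)\<^sup>2 / q\<^sup>2"
    using qW q W by (intro divide_left_mono) auto
  also have "\<dots> \<le> (w x y)\<^sup>2 / (w x y powr \<beta> / M)\<^sup>2"
    using lower w M q by (intro divide_left_mono power_mono) auto
  also have "\<dots> = M\<^sup>2 * w x y powr (2 - 2 * \<beta>)"
    using w M by (simp add: powr_diff power_divide powr_power mult.commute)
  finally have ratio: "(w x y)\<^sup>2 / W \<le> M\<^sup>2 * w x y powr (2 - 2 * \<beta>)" .
  have "(\<Sum>t\<in>{1..T}. (wt t x y / coll_prob (H t) x y)\<^sup>2 * min (coll_prob (H t) x y) (coll_prob (H t) z y))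
      \<le> (\<Sum>t\<in>{1..T}. (coll_prob (H t) x y)\<^sup>2 * ((w x y)\<^sup>2 / W\<^sup>2 * p_star T H z y))"
  proof (rule sum_mono)
    fix t assume t: "t \<in> {1..T}"
    have "(wt t x y / coll_prob (H t) x y)\<^sup>2 = (coll_prob (H t) x y)\<^sup>2 * ((w x y)\<^sup>2 / W\<^sup>2)"
      unfolding p2_coefficient_eq[OF p2 t x] W_def by (simp add: power_divide power_mult_distrib)
    \<comment> \<open>Bounding the minimum through \<open>z\<close> keeps the squared collision
      probabilities at \<open>x\<close> intact, so that their sum over \<open>t\<close> is exactly
      \<open>W\<close>.\<close>
    moreover have "min (coll_prob (H t) x y) (coll_prob (H t) z y) \<le> p_star T H z y"
      using coll_prob_le_p_star[OF t, of H z y] by simp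
    ultimately show "(wt t x y / coll_prob (H t) x y)\<^sup>2 * min (coll_prob (H t) x y) (coll_prob (H t) z y) \<le>
        (coll_prob (H t) x y)\<^sup>2 * ((w x y)\<^sup>2 / W\<^sup>2 * p_star T H z y)"
      unfolding mult.assoc[symmetric] by (simp only:) (rule mult_left_mono; simp)
  qed
  also have "\<dots> = W * ((w x y)\<^sup>2 / W\<^sup>2 * p_star T H z y)"
    by (subst sum_distrib_right[symmetric]) (simp only: W_def sq_weight_sum_eq)
  also have "\<dots> = (w x y)\<^sup>2 / W * p_star T H z y"
    using W by (simp add: power2_eq_square)
  also have "\<dots> \<le> (M\<^sup>2 * w x y powr (2 - 2 * \<beta>)) * (M * rpow (w z y) \<beta>)"
    using ratio pz sf z by (intro mult_mono) (auto simp: scale_free_def)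
  also have "\<dots> = M ^ 3 * (w x y powr (2 - 2 * \<beta>) * rpow (w z y) \<beta>)"
    by (simp add: power2_eq_square power3_eq_cube)
  finally show ?thesis .
qed

section \<open>Assembly of the second moment bound\<close>

theorem theorem6:
  fixes X :: "'a set"
    and w :: "'a \<Rightarrow> 'a \<Rightarrow> real"
    and M \<beta> :: real
    and T :: nat
    and H :: "nat \<Rightarrow> ('a, 'u) hash_pair measure"
    and wt :: "nat \<Rightarrow> 'a \<Rightarrow> 'a \<Rightarrow> real"
    and y :: 'a
  assumes "finite X"
    and "\<And>x z. 0 \<le> w x z \<and> w x z \<le> 1"
    and "M \<ge> 1"
    and "0 \<le> \<beta>" and "\<beta> \<le> 1"
    and "\<And>t. t \<in> {1..T} \<Longrightarrow> hashing_scheme (H t)"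
    and "p2_weighted X T H w wt"
    and "unbiased X T H w"
    and "scale_free X T H w \<beta> M"
  shows "integrable (mr_law X T H y) (\<lambda>\<omega>. (mr_estimator X T H wt y \<omega>)\<^sup>2) \<and>
         integral\<^sup>L (mr_law X T H y) (\<lambda>\<omega>. (mr_estimator X T H wt y \<omega>)\<^sup>2)
           \<le> V_bound \<beta> M (mean_weight X w y)"
proof -
  note X = assms(1) and hs = assms(6) and p2 = assms(7) and ub = assms(8) and sf = assms(9)
  have w: "0 \<le> w x y" "w x y \<le> 1" for x
    using assms(2) by auto
  define n where "n = real (card X)"
  define \<mu> where "\<mu> = mean_weight X w y"
  define c where "c t x = wt t x y / coll_prob (H t) x y" for t x
  define \<phi> where "\<phi> t z = (case snd z of None \<Rightarrow> 0
      | Some x \<Rightarrow> c t x * real (card (bucket X (fst z) y)))" for t and z :: "('a, 'u) hash_pair \<times> 'a option"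
  \<comment> \<open>Nonnegativity is claimed on \<open>X\<close> only, the range in which
    \<open>p2_weighted\<close> fixes the weights.\<close>
  have c: "0 \<le> c t x" if "t \<in> {1..T}" "x \<in> X" for t x
    unfolding c_def p2_coefficient_eq[OF p2 that]
    using w by (auto simp: sq_weight_sum_eq coll_prob_nonneg intro!: sum_nonneg divide_nonneg_nonneg)
  have meas: "\<phi> t \<in> borel_measurable (sample_law X (H t) y)"
    and int: "integrable (sample_law X (H t) y) (\<lambda>z. (\<phi> t z)\<^sup>2)"
    and first: "(\<integral>z. \<phi> t z \<partial>sample_law X (H t) y) = (\<Sum>x\<in>X. c t x * coll_prob (H t) x y)"
    and second: "(\<integral>z. (\<phi> t z)\<^sup>2 \<partial>sample_law X (H t) y) \<le>
      (\<Sum>x\<in>X. \<Sum>z\<in>X. (c t x)\<^sup>2 * min (coll_prob (H t) x y) (coll_prob (H t) z y))"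
    if t: "t \<in> {1..T}" for t
    unfolding \<phi>_def
    by (rule sample_law_estimator_measurable[OF hs[OF t] X c[OF t]]
        sample_law_estimator_square_integrable[OF hs[OF t] X c[OF t]]
        sample_law_estimator_expectation[OF hs[OF t] X c[OF t]]
        sample_law_estimator_second_moment[OF hs[OF t] X c[OF t]]; assumption)+
  note moments = second_moment_sum_PiM_le[OF finite_atLeastAtMost prob_space_sample_law[OF hs X] meas int]
  have est: "(mr_estimator X T H wt y \<omega>)\<^sup>2 = 1 / n\<^sup>2 * (\<Sum>t\<in>{1..T}. \<phi> t (\<omega> t))\<^sup>2" for \<omega>
    unfolding mr_estimator_def \<phi>_def c_def n_def by (simp add: power_mult_distrib power_divide)
  have integrable: "integrable (mr_law X T H y) (\<lambda>\<omega>. (mr_estimator X T H wt y \<omega>)\<^sup>2)"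
    unfolding est mr_law_def by (intro integrable_mult_right moments(1)) auto
  have means: "(\<Sum>t\<in>{1..T}. \<integral>z. \<phi> t z \<partial>sample_law X (H t) y) = (\<Sum>x\<in>X. w x y)"
  proof -
    have "(\<Sum>t\<in>{1..T}. \<integral>z. \<phi> t z \<partial>sample_law X (H t) y) =
        (\<Sum>t\<in>{1..T}. \<Sum>x\<in>X. c t x * coll_prob (H t) x y)"
      using first by (intro sum.cong) auto
    also have "\<dots> = (\<Sum>x\<in>X. \<Sum>t\<in>{1..T}. c t x * coll_prob (H t) x y)"
      by (rule sum.swap)
    also have "\<dots> = (\<Sum>x\<in>X. w x y)"
      unfolding c_def by (intro sum.cong refl p2_coefficient_sum[OF p2 ub] w)
    finally show ?thesis .
  qed
  have squares: "(\<Sum>t\<in>{1..T}. \<integral>z. (\<phi> t z)\<^sup>2 \<partial>sample_law X (H t) y) \<le>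
      M ^ 3 * ((\<Sum>x\<in>X. w x y powr (2 - 2 * \<beta>)) * (\<Sum>x\<in>X. rpow (w x y) \<beta>))"
  proof -
    have "(\<Sum>t\<in>{1..T}. \<integral>z. (\<phi> t z)\<^sup>2 \<partial>sample_law X (H t) y) \<le>
        (\<Sum>t\<in>{1..T}. \<Sum>x\<in>X. \<Sum>z\<in>X. (c t x)\<^sup>2 * min (coll_prob (H t) x y) (coll_prob (H t) z y))"
      by (intro sum_mono second)
    also have "\<dots> = (\<Sum>x\<in>X. \<Sum>z\<in>X. \<Sum>t\<in>{1..T}. (c t x)\<^sup>2 * min (coll_prob (H t) x y) (coll_prob (H t) z y))"
      by (subst sum.swap) (intro sum.cong refl sum.swap)
    also have "\<dots> \<le> (\<Sum>x\<in>X. \<Sum>z\<in>X. M ^ 3 * (w x y powr (2 - 2 * \<beta>) * rpow (w z y) \<beta>))"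
      unfolding c_def by (intro sum_mono p2_coefficient_square_sum_le[OF p2 ub sf assms(3)] w)
    also have "\<dots> = M ^ 3 * ((\<Sum>x\<in>X. w x y powr (2 - 2 * \<beta>)) * (\<Sum>x\<in>X. rpow (w x y) \<beta>))"
      unfolding sum_product by (simp add: sum_distrib_left)
    finally show ?thesis .
  qed
  \<comment> \<open>For empty \<open>X\<close> the mean is 0 by the division convention and both
    sides of the equation vanish.\<close>
  have \<mu>: "0 \<le> \<mu>" "(\<Sum>x\<in>X. w x y) = n * \<mu>"
    using X by (auto simp: \<mu>_def mean_weight_def n_def w intro!: divide_nonneg_nonneg sum_nonneg)
  have powers: "(\<Sum>x\<in>X. w x y powr (2 - 2 * \<beta>)) * (\<Sum>x\<in>X. rpow (w x y) \<beta>) \<le>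
      n\<^sup>2 * (\<mu>\<^sup>2 * (1 / rpow \<mu> \<beta> + 1 / rpow \<mu> (1 - \<beta>)))"
  proof (cases "\<mu> = 0")
    \<comment> \<open>All weights vanish, and \<open>0 powr\<close> is 0 even for exponent 0, so the
      first factor is 0 also when \<beta> = 1.\<close>
    case True
    then have "\<forall>x\<in>X. w x y = 0"
      using \<mu>(2) X w by (simp add: sum_nonneg_eq_0_iff)
    then show ?thesis using True by simp
  next
    case False
    then show ?thesis
      unfolding n_def using \<mu> w assms(4,5) X by (intro sum_power_product_le) (auto simp: n_def)
  qed
  \<comment> \<open>The bracketed term of \<open>V_bound\<close> with constant 1; as it is
    nonnegative, it can be enlarged to the constant 8 at the end.\<close>
  define B where "B = M ^ 3 * (\<mu>\<^sup>2 * (1 / rpow \<mu> \<beta> + 1 / rpow \<mu> (1 - \<beta>)))"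
  have B: "0 \<le> B"
    using assms(3) by (auto simp: B_def rpow_def intro!: mult_nonneg_nonneg)
  have "(\<integral>\<omega>. (\<Sum>t\<in>{1..T}. \<phi> t (\<omega> t))\<^sup>2 \<partial>mr_law X T H y) \<le>
      (\<Sum>t\<in>{1..T}. \<integral>z. (\<phi> t z)\<^sup>2 \<partial>sample_law X (H t) y) + (n * \<mu>)\<^sup>2"
    unfolding mr_law_def \<mu>(2)[symmetric] means[symmetric] by (rule moments(2))
  also have "\<dots> \<le> n\<^sup>2 * B + (n * \<mu>)\<^sup>2"
    using order.trans[OF squares mult_left_mono[OF powers, of "M ^ 3"]] assms(3)
    by (simp add: B_def mult_ac)
  finally have "(\<integral>\<omega>. (\<Sum>t\<in>{1..T}. \<phi> t (\<omega> t))\<^sup>2 \<partial>mr_law X T H y) \<le> n\<^sup>2 * (B + \<mu>\<^sup>2)"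
    by (simp add: power_mult_distrib algebra_simps)
  then have "(\<integral>\<omega>. (mr_estimator X T H wt y \<omega>)\<^sup>2 \<partial>mr_law X T H y) \<le> 1 / n\<^sup>2 * (n\<^sup>2 * (B + \<mu>\<^sup>2))"
    unfolding est integral_mult_right_zero by (intro mult_left_mono) auto
  \<comment> \<open>Only an inequality, since for \<open>n = 0\<close> the left-hand side collapses
    to 0.\<close>
  also have "\<dots> \<le> B + \<mu>\<^sup>2"
    using B by (cases "n = 0") auto
  also have "\<dots> \<le> V_bound \<beta> M \<mu>"
    using B by (simp add: V_bound_def B_def mult.assoc)
  finally show ?thesis
    using integrable unfolding \<mu>_def by simp
qed

end
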